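(* Let $(M,D)$ be a compact metric space and let $(\mathcal{F},\mu)$, $\mathcal{F}=\{f_i\}_{i\in\mathcal{I}}$, be a random dynamical system of continuous maps on $M$ such that $\mathcal{F}$ is proximal on $(M,D)$ and $(\mathcal{F},\mu)$ has the local contraction property on $(M,D)$. Let $\nu$ be the (unique) $\mu$-stationary probability measure on $M$. If all maps in $\mathcal{F}$ are injective, then the following dichotomy holds: either $\nu$ is a Dirac measure $\delta_{x_0}$ at a point $x_0\in M$ which is a fixed point of $f_i$ for $\mu$-almost every $i\in\mathcal{I}$, or $\nu$ is non-atomic.
   Context: Random dynamical system: $C^0(M)$ is the space of continuous maps $f\colon M\to M$ with the supremum distance $D_\infty(f,g)=\sup_{x\in M}D(f(x),g(x))$. $\mathcal{F}=\{f_i\}_{i\in\mathcal{I}}\subset C^0(M)$ is indexed by a set $\mathcal{I}$ (one may take $\mathcal{I}=\mathcal{F}$); $\mathcal{I}$ carries the $\sigma$-algebra (and topology) induced by that of $(\mathcal{F},D_\infty)$, and $\mu$ is a probability measure on $\mathcal{I}$ which is non-degenerate, i.e. the support of $\mu$ is $\mathcal{I}$. $\mu^{\mathbb{N}}$ is the product measure on $\mathcal{I}^{\mathbb{N}}$. For $\mathbf{i}=(i_1,i_2,\ldots)\in\mathcal{I}^{\mathbb{N}}$ and $n\in\mathbb{N}$ put $f_{\mathbf{i}}^n=f_{i_n}\circ\cdots\circ f_{i_1}$. A Borel probability measure $\nu$ on $M$ is $\mu$-stationary if $\nu=\int (f_i)_*\nu\,d\mu(i)$, where $(f_i)_*\nu=\nu\circ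 f_i^{-1}$. Under the hypotheses of the claim the $\mu$-stationary probability measure is unique. Proximal: for every $x,y\in M$ there exist $\mathbf{i}\in\mathcal{I}^{\mathbb{N}}$ and a (strictly increasing) sequence $(n_k)_{k}$ with $\lim_{k\to\infty}D(f_{\mathbf{i}}^{n_k}(x),f_{\mathbf{i}}^{n_k}(y))=0$. Local contraction property: there exists $q\in(0,1)$ such that for every $x\in M$, for $\mu^{\mathbb{N}}$-almost every $\mathbf{i}\in\mathcal{I}^{\mathbb{N}}$ there exists a neighborhood $B$ of $x$ such that $\operatorname{diam}_D(f_{\mathbf{i}}^n(B))\le q^n$ for all $n\in\mathbb{N}$. *)

theory Defs
  imports "HOL-Probability.Probability"
begin

text \<open>
  The compact metric space \<open>M\<close> is a type \<open>'a::metric_space\<close> whose universe is compact. Every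
  continuous self-map is then bounded, so \<open>'a \<Rightarrow>\<^sub>C 'a\<close> with its library metric
  \<open>dist f g = (SUP x. dist (f x) (g x))\<close> is the space \<open>C\<^sup>0(M)\<close> with \<open>D\<^sub>\<infinity>\<close>.
  The family \<open>f\<close> is indexed by the set \<open>I\<close> and need not be injective in the index.
\<close>

definition index_topology :: "'i set \<Rightarrow> ('i \<Rightarrow> ('a::metric_space \<Rightarrow>\<^sub>C 'a)) \<Rightarrow> 'i topology" where
  "index_topology I f = pullback_topology I f euclidean"

definition index_algebra :: "'i set \<Rightarrow> ('i \<Rightarrow> ('a::metric_space \<Rightarrow>\<^sub>C 'a)) \<Rightarrow> 'i measure" where
  "index_algebra I f = vimage_algebra I f borel"

definition measure_support :: "'i topology \<Rightarrow> 'i measure \<Rightarrow> 'i set" where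
  "measure_support T \<mu> = {i \<in> topspace T. \<forall>U. openin T U \<and> i \<in> U \<longrightarrow> emeasure \<mu> U > 0}"

definition random_dynamical_system ::
    "'i set \<Rightarrow> ('i \<Rightarrow> ('a::metric_space \<Rightarrow>\<^sub>C 'a)) \<Rightarrow> 'i measure \<Rightarrow> bool" where
  "random_dynamical_system I f \<mu> \<longleftrightarrow>
     prob_space \<mu> \<and> space \<mu> = I \<and> sets \<mu> = sets (index_algebra I f) \<and>
     measure_support (index_topology I f) \<mu> = I"

text \<open>Sequences are indexed from \<open>0\<close>: the entry \<open>w k\<close> is the index \<open>i\<^sub>k\<^sub>+\<^sub>1\<close>.\<close>

primrec random_orbit ::
    "('i \<Rightarrow> ('a::metric_space \<Rightarrow>\<^sub>C 'a)) \<Rightarrow> (nat \<Rightarrow> 'i) \<Rightarrow> nat \<Rightarrow> 'a \<Rightarrow> 'a" where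
  "random_orbit f w 0 = id"
| "random_orbit f w (Suc n) = apply_bcontfun (f (w n)) \<circ> random_orbit f w n"

definition proximal :: "'i set \<Rightarrow> ('i \<Rightarrow> ('a::metric_space \<Rightarrow>\<^sub>C 'a)) \<Rightarrow> bool" where
  "proximal I f \<longleftrightarrow>
     (\<forall>x y. \<exists>w \<in> UNIV \<rightarrow> I. \<exists>r :: nat \<Rightarrow> nat. strict_mono r \<and>
        (\<lambda>k. dist (random_orbit f w (r k) x) (random_orbit f w (r k) y)) \<longlonglongrightarrow> 0)"

definition local_contraction ::
    "('i \<Rightarrow> ('a::metric_space \<Rightarrow>\<^sub>C 'a)) \<Rightarrow> 'i measure \<Rightarrow> bool" where
  "local_contraction f \<mu> \<longleftrightarrow>
     (\<exists>q::real. 0 < q \<and> q < 1 \<and>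
        (\<forall>x. AE w in (\<Pi>\<^sub>M k\<in>(UNIV :: nat set). \<mu>).
           \<exists>B. x \<in> interior B \<and> (\<forall>n\<ge>1. diameter (random_orbit f w n ` B) \<le> q ^ n)))"

definition stationary ::
    "('i \<Rightarrow> ('a::metric_space \<Rightarrow>\<^sub>C 'a)) \<Rightarrow> 'i measure \<Rightarrow> 'a measure \<Rightarrow> bool" where
  "stationary f \<mu> \<nu> \<longleftrightarrow>
     prob_space \<nu> \<and> sets \<nu> = sets borel \<and>
     (\<forall>A \<in> sets borel. emeasure \<nu> A = (\<integral>\<^sup>+ i. emeasure (distr \<nu> borel (f i)) A \<partial>\<mu>))"

definition measure_atom :: "'a measure \<Rightarrow> 'a set \<Rightarrow> bool" where
  "measure_atom \<nu> A \<longleftrightarrow>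
     A \<in> sets \<nu> \<and> emeasure \<nu> A > 0 \<and>
     (\<forall>B \<in> sets \<nu>. B \<subseteq> A \<longrightarrow> emeasure \<nu> B = 0 \<or> emeasure \<nu> (A - B) = 0)"

definition non_atomic :: "'a measure \<Rightarrow> bool" where
  "non_atomic \<nu> \<longleftrightarrow> (\<nexists>A. measure_atom \<nu> A)"

end

theory Submission
  imports Defs
begin

text \<open>
  If \<open>\<nu>\<close> has an atom, let \<open>K\<close> be the finite set of points of maximal mass. Stationarity and
  injectivity force \<open>f\<^sub>i K = K\<close> for almost every \<open>i\<close>, hence \<open>f\<^sub>i K \<subseteq> K\<close> for every \<open>i\<close>
  because \<open>\<mu>\<close> has full support. All maps permute the finite set \<open>K\<close>, so proximality leaves a single
  point \<open>x\<^sub>0\<close>, fixed by every \<open>f\<^sub>i\<close>.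

  By local contraction, an orbit started near \<open>x\<^sub>0\<close> converges to \<open>x\<^sub>0\<close> with probability at least
  \<open>1/2\<close>. Since \<open>\<nu>(cball x\<^sub>0 r)\<close> is the \<open>\<nu>\<close>-average of the probability that the orbit is in
  \<open>cball x\<^sub>0 r\<close> at time \<open>n\<close>, letting \<open>n \<rightarrow> \<infinity>\<close> and then \<open>r \<rightarrow> 0\<close> shows that mass near but not at
  \<open>x\<^sub>0\<close> would add to the mass of \<open>x\<^sub>0\<close>; so a punctured ball around \<open>x\<^sub>0\<close> is null. Being locally
  \<open>\<nu>\<close>-null off \<open>x\<^sub>0\<close> pulls back under every \<open>f\<^sub>i\<close>, and by proximality every point can be steered
  into the ball; hence \<open>\<nu> = \<delta>\<close> at \<open>x\<^sub>0\<close> by compactness.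
\<close>

section \<open>Dense sequences, joint measurability and limits\<close>

lemma compact_UNIV_dense_seq:
  assumes "compact (UNIV :: 'a set)"
  obtains p :: "nat \<Rightarrow> 'a::metric_space" where "\<And>y e. e > 0 \<Longrightarrow> \<exists>j. dist y (p j) < e"
proof -
  have "\<forall>e>0. \<exists>k. finite k \<and> (UNIV :: 'a set) \<subseteq> (\<Union>x\<in>k. ball x e)"
    using assms compact_eq_totally_bounded by blast
  then have "\<forall>n. \<exists>k. finite k \<and> (UNIV :: 'a set) \<subseteq> (\<Union>x\<in>k. ball x (inverse (real (Suc n))))"
    by simp
  then obtain k where k: "\<And>n. finite (k n)"
    "\<And>n. (UNIV :: 'a set) \<subseteq> (\<Union>x\<in>k n. ball x (inverse (real (Suc n))))"
    by metis
  let ?D = "\<Union>n. k n"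
  have "countable ?D" using k(1) by (simp add: countable_finite)
  moreover have "?D \<noteq> {}" using k(2)[of 0] by fastforce
  ultimately have r: "range (from_nat_into ?D) = ?D" by simp
  show thesis
  proof (rule that)
    fix y :: 'a and e :: real assume "e > 0"
    then obtain n where n: "inverse (real (Suc n)) < e" using reals_Archimedean by blast
    obtain x where x: "x \<in> k n" "dist x y < inverse (real (Suc n))" using k(2)[of n] by fastforce
    then obtain j where "x = from_nat_into ?D j" using r by blast
    then show "\<exists>j. dist y (from_nat_into ?D j) < e"
      using x(2) n by (metis dist_commute order.strict_trans)
  qed
qed

text \<open>
  Neither space is assumed second countable, so continuity of \<open>g\<close> in the second argument is used
  through approximation by countably many sections.
\<close>

lemma measurable_caratheodory:
  fixes g :: "'i \<Rightarrow> 'a::metric_space \<Rightarrow> 'b::metric_space"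
  assumes compact: "compact (UNIV :: 'a set)"
    and meas: "\<And>y. (\<lambda>i. g i y) \<in> borel_measurable M"
    and cont: "\<And>i. i \<in> space M \<Longrightarrow> continuous_on UNIV (g i)"
  shows "case_prod g \<in> borel_measurable (M \<Otimes>\<^sub>M borel)"
proof -
  obtain p :: "nat \<Rightarrow> 'a" where p: "\<And>y e. e > 0 \<Longrightarrow> \<exists>j. dist y (p j) < e"
    using compact_UNIV_dense_seq[OF compact] by blast
  \<comment> \<open>\<open>p (c k y)\<close> tends to \<open>y\<close> as \<open>k\<close> grows,
    while \<open>c k\<close> takes values in \<open>nat\<close>. Taking the least admissible index
    makes \<open>c k\<close> measurable, so \<open>g i (p (c k y))\<close> is glued from countably
    many sections and is jointly measurable.\<close>
  define c where "c k y = (LEAST j. dist y (p j) < inverse (real (Suc k)))" for k y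
  have c: "dist y (p (c k y)) < inverse (real (Suc k))" for k y
    unfolding c_def by (rule LeastI_ex, rule p) simp
  have [measurable]: "c k \<in> measurable borel (count_space UNIV)" for k
    unfolding c_def
  proof (rule measurable_Least)
    fix j
    have "open {y. dist y (p j) < inverse (real (Suc k))}"
      by (intro open_Collect_less continuous_intros)
    then show "Measurable.pred borel (\<lambda>y. dist y (p j) < inverse (real (Suc k)))"
      by (simp add: pred_def)
  qed
  have lim: "(\<lambda>k. p (c k y)) \<longlonglongrightarrow> y" for y
  proof (rule metric_tendsto_imp_tendsto[OF LIMSEQ_inverse_real_of_nat])
    show "\<forall>\<^sub>F k in sequentially. dist (p (c k y)) y \<le> dist (inverse (real (Suc k))) 0"
      using c[of y] by (intro always_eventually allI) (simp add: dist_commute less_imp_le del: of_nat_Suc)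
  qed
  show ?thesis
  proof (rule borel_measurable_LIMSEQ_metric)
    fix k
    show "(\<lambda>x. g (fst x) (p (c k (snd x)))) \<in> borel_measurable (M \<Otimes>\<^sub>M borel)"
      by (rule measurable_compose_countable[where f = "\<lambda>j x. g (fst x) (p j)"])
         (use meas in measurable)
  next
    fix x assume "x \<in> space (M \<Otimes>\<^sub>M (borel :: 'a measure))"
    then have "fst x \<in> space M" by (auto simp: space_pair_measure)
    then have "isCont (g (fst x)) (snd x)"
      using cont by (simp add: continuous_on_eq_continuous_at)
    then have "(\<lambda>k. g (fst x) (p (c k (snd x)))) \<longlonglongrightarrow> g (fst x) (snd x)"
      using lim isCont_tendsto_compose by blast
    then show "(\<lambda>k. g (fst x) (p (c k (snd x)))) \<longlonglongrightarrow> case_prod g x"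
      by (simp add: case_prod_beta)
  qed
qed

text \<open>Countable quantifiers over strict inequalities make the event that an orbit converges to
  a given point visibly measurable.\<close>

lemma nonneg_tendsto_0_iff:
  fixes g :: "nat \<Rightarrow> real"
  assumes "\<And>n. g n \<ge> 0"
  shows "g \<longlonglongrightarrow> 0 \<longleftrightarrow> (\<forall>k. \<exists>N. \<forall>n\<ge>N. g n < inverse (real (Suc k)))"
proof
  assume "g \<longlonglongrightarrow> 0"
  then show "\<forall>k. \<exists>N. \<forall>n\<ge>N. g n < inverse (real (Suc k))"
    using order_tendstoD(2)[of g 0] by (force simp: eventually_sequentially)
next
  assume g: "\<forall>k. \<exists>N. \<forall>n\<ge>N. g n < inverse (real (Suc k))"
  show "g \<longlonglongrightarrow> 0"
  proof (rule LIMSEQ_I)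
    fix e :: real assume "e > 0"
    then obtain k where k: "inverse (real (Suc k)) < e" using reals_Archimedean by blast
    obtain N where "\<forall>n\<ge>N. g n < inverse (real (Suc k))" using g by blast
    then show "\<exists>N. \<forall>n\<ge>N. norm (g n - 0) < e"
      using k assms by (intro exI[of _ N]) (auto simp del: of_nat_Suc intro: order.strict_trans)
  qed
qed

text \<open>The recursion of \<open>random_orbit\<close> splits off the last map; conditioning on
  the first index requires splitting off the first one.\<close>

lemma random_orbit_case_nat:
  "random_orbit f (case_nat i w) (Suc n) y = random_orbit f w n (apply_bcontfun (f i) y)"
  by (induction n) auto

lemma random_orbit_fixed:
  assumes "\<And>k. apply_bcontfun (f (w k)) x = x"
  shows "random_orbit f w n x = x"
  by (induction n) (use assms in auto)

lemma random_orbit_inj: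
  assumes "\<And>k. inj (apply_bcontfun (f (w k)))"
  shows "inj (random_orbit f w n)"
  by (induction n) (use assms in \<open>auto simp del: comp_apply intro: inj_compose\<close>)

lemma random_orbit_in:
  assumes "\<And>k. apply_bcontfun (f (w k)) ` A \<subseteq> A" "x \<in> A"
  shows "random_orbit f w n x \<in> A"
  by (induction n) (use assms in auto)

section \<open>Null sets and atoms on a compact metric space\<close>

lemma compact_locally_null:
  fixes M :: "'a::metric_space measure"
  assumes "compact (UNIV :: 'a set)" "sets M = sets borel" "A \<in> sets borel"
    and loc: "\<And>x. \<exists>V. open V \<and> x \<in> V \<and> emeasure M (A \<inter> V) = 0"
  shows "emeasure M A = 0"
proof -
  obtain V where V: "\<And>x. open (V x)" "\<And>x. x \<in> V x" "\<And>x. emeasure M (A \<inter> V x) = 0"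
    using loc by metis
  obtain C where C: "finite C" "UNIV \<subseteq> (\<Union>x\<in>C. V x)"
    by (rule compactE_image[OF assms(1), of UNIV V]) (use V in auto)
  have "(\<Union>x\<in>C. A \<inter> V x) \<in> null_sets M"
    using C(1) V(1,3) assms(2,3) by (intro null_sets_UN' countable_finite) (auto simp: null_sets_def)
  moreover have "(\<Union>x\<in>C. A \<inter> V x) = A" using C(2) by auto
  ultimately show ?thesis by auto
qed

text \<open>By compactness some point \<open>x\<close> sees mass of \<open>A\<close> in each of its
  neighbourhoods. An atom cannot be split, so \<open>A\<close> outside every ball around
  \<open>x\<close> is null; shrinking the balls leaves all mass of \<open>A\<close> at
  \<open>x\<close>.\<close>

lemma atom_imp_point_mass:
  fixes M :: "'a::metric_space measure"
  assumes compact: "compact (UNIV :: 'a set)" and sets: "sets M = sets borel"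
    and atom: "measure_atom M A"
  shows "\<exists>x. emeasure M {x} > 0"
proof -
  have A: "A \<in> sets borel" "emeasure M A > 0" using atom sets by (auto simp: measure_atom_def)
  obtain x where x: "\<And>V. open V \<Longrightarrow> x \<in> V \<Longrightarrow> emeasure M (A \<inter> V) \<noteq> 0"
    using compact_locally_null[OF compact sets A(1)] A(2) by fastforce
  have "emeasure M (A - ball x (inverse (Suc n))) = 0" for n
  proof -
    have "A \<inter> ball x (inverse (Suc n)) \<in> sets M" using A sets by auto
    then have "emeasure M (A - (A \<inter> ball x (inverse (Suc n)))) = 0"
      using atom x[of "ball x (inverse (Suc n))"] unfolding measure_atom_def by fastforce
    then show ?thesis by (simp add: Diff_Int)
  qed
  then have "(\<Union>n. A - ball x (inverse (Suc n))) \<in> null_sets M"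
    using A sets by (intro null_sets_UN') (auto simp: null_sets_def)
  moreover have "A - {x} \<subseteq> (\<Union>n. A - ball x (inverse (Suc n)))"
  proof
    fix y assume y: "y \<in> A - {x}"
    then obtain n where "inverse (real (Suc n)) < dist x y" 
      using reals_Archimedean[of "dist x y"] by auto
    then show "y \<in> (\<Union>n. A - ball x (inverse (Suc n)))" using y by (auto intro!: exI[of _ n])
  qed
  ultimately have "emeasure M (A - {x}) = 0"
    using A sets by (metis emeasure_eq_0 null_setsD1 null_setsD2)
  then have "emeasure M A \<le> emeasure M {x}"
    using emeasure_subadditive[of "A - {x}" M "{x}"] emeasure_mono[of A "(A - {x}) \<union> {x}" M] A sets
    by (auto intro: order_trans)
  then show ?thesis using A by (intro exI[of _ x]) (auto elim: less_le_trans)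
qed

lemma (in finite_measure) finite_large_points:
  assumes "\<And>x. {x} \<in> sets M" "c > 0"
  shows "finite {x. measure M {x} \<ge> c}"
proof (rule ccontr)
  assume inf: "infinite {x. measure M {x} \<ge> c}"
  obtain n :: nat where n: "measure M (space M) < n * c"
    using assms(2) reals_Archimedean3 by blast
  obtain F where F: "F \<subseteq> {x. measure M {x} \<ge> c}" "finite F" "card F = n"
    using infinite_arbitrarily_large[OF inf] by blast
  have "n * c = (\<Sum>x\<in>F. c)" using F by simp
  also have "\<dots> \<le> (\<Sum>x\<in>F. measure M {x})" using F by (intro sum_mono) auto
  also have "\<dots> = measure M F"
    using F(2) assms(1) by (rule finite_measure_eq_sum_singleton[symmetric])
  also have "\<dots> \<le> measure M (space M)" by (rule bounded_measure)
  finally show False using n by simp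
qed

section \<open>The random system: measurability and full support\<close>

locale compact_rds =
  fixes I :: "'i set" and f :: "'i \<Rightarrow> ('a::metric_space \<Rightarrow>\<^sub>C 'a)" and \<mu> :: "'i measure"
    and \<nu> :: "'a measure"
  assumes compact: "compact (UNIV :: 'a set)"
    and rds: "random_dynamical_system I f \<mu>"
    and stat: "stationary f \<mu> \<nu>"
    and inj: "\<And>i. i \<in> I \<Longrightarrow> inj (apply_bcontfun (f i))"
begin

sublocale \<mu>: prob_space \<mu>
  using rds by (simp add: random_dynamical_system_def)

sublocale \<nu>: prob_space \<nu>
  using stat by (simp add: stationary_def)

sublocale sequence_space \<mu> ..

sublocale pair: pair_prob_space \<mu> \<nu> ..

lemma space_mu [simp]: "space \<mu> = I"
  using rds by (simp add: random_dynamical_system_def)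

lemma sets_nu [measurable_cong, simp]: "sets \<nu> = sets borel"
  using stat by (simp add: stationary_def)

lemma space_nu [simp]: "space \<nu> = UNIV"
  using sets_eq_imp_space_eq[OF sets_nu] by simp

lemma in_space_S: "w \<in> space S \<Longrightarrow> w k \<in> I"
  by (auto simp: space_PiM PiE_iff)

lemma measurable_index: "f \<in> measurable \<mu> borel"
proof -
  have "f \<in> measurable (index_algebra I f) borel"
    unfolding index_algebra_def by (rule measurable_vimage_algebra1) simp
  moreover have "sets \<mu> = sets (index_algebra I f)"
    using rds by (simp add: random_dynamical_system_def)
  ultimately show ?thesis by (simp cong: measurable_cong_sets)
qed

lemma measurable_apply [measurable]: "(\<lambda>(i, y). f i y) \<in> borel_measurable (\<mu> \<Otimes>\<^sub>M borel)"
proof (rule measurable_caratheodory[OF compact])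
  fix y
  have "continuous_on UNIV (\<lambda>g :: 'a \<Rightarrow>\<^sub>C 'a. apply_bcontfun g y)"
    unfolding continuous_on_iff using dist_bounded le_less_trans by blast
  then show "(\<lambda>i. f i y) \<in> borel_measurable \<mu>"
    using measurable_compose[OF measurable_index borel_measurable_continuous_onI] by blast
qed (simp add: continuous_on_apply_bcontfun)

lemma measurable_f [measurable]: "apply_bcontfun (f i) \<in> borel_measurable borel"
  by (intro borel_measurable_continuous_onI continuous_on_apply_bcontfun)

text \<open>The indices whose maps are uniformly \<open>e\<close>-close to \<open>f i\<close> form
  an open set, which has positive measure by full support and so meets every event of full measure.
  This is the bridge from almost every index to every index.\<close>

lemma support_AE_ex:
  assumes "AE j in \<mu>. Q j" "i \<in> I" "e > 0"
  shows "\<exists>j\<in>I. dist (f j) (f i) < e \<and> Q j"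
proof (rule ccontr)
  assume no: "\<not> ?thesis"
  let ?U = "f -` ball (f i) e \<inter> I"
  have U: "?U \<in> sets \<mu>" using measurable_sets[OF measurable_index, of "ball (f i) e"] by simp
  have "openin (index_topology I f) ?U"
    unfolding index_topology_def openin_pullback_topology by (auto intro!: exI[of _ "ball (f i) e"])
  moreover have "i \<in> measure_support (index_topology I f) \<mu>"
    using rds assms(2) by (simp add: random_dynamical_system_def)
  ultimately have "emeasure \<mu> ?U > 0"
    using assms(2,3) unfolding measure_support_def by auto
  moreover have "AE j in \<mu>. j \<notin> ?U"
    using assms(1) AE_space by eventually_elim (use no in \<open>auto simp: dist_commute\<close>)
  then have "emeasure \<mu> ?U = 0" using U by (subst (asm) AE_iff_measurable[OF U]) (auto simp: sets.sets_into_space)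
  ultimately show False by simp
qed

section \<open>Stationarity along one step and along random orbits\<close>

lemma emeasure_nu_eq:
  assumes "A \<in> sets borel"
  shows "emeasure \<nu> A = (\<integral>\<^sup>+ i. emeasure \<nu> (f i -` A) \<partial>\<mu>)"
proof -
  have "emeasure \<nu> A = (\<integral>\<^sup>+ i. emeasure (distr \<nu> borel (f i)) A \<partial>\<mu>)"
    using stat assms unfolding stationary_def by blast
  also have "\<dots> = (\<integral>\<^sup>+ i. emeasure \<nu> (f i -` A) \<partial>\<mu>)"
    using assms by (intro nn_integral_cong) (simp add: emeasure_distr)
  finally show ?thesis .
qed

lemma measurable_emeasure_vimage [measurable]:
  assumes [measurable]: "A \<in> sets borel"
  shows "(\<lambda>i. emeasure \<nu> (f i -` A)) \<in> borel_measurable \<mu>"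
proof -
  have "(\<lambda>(i, y). f i y) -` A \<inter> space (\<mu> \<Otimes>\<^sub>M \<nu>) \<in> sets (\<mu> \<Otimes>\<^sub>M \<nu>)" by measurable
  from \<nu>.measurable_emeasure_Pair[OF this] show ?thesis
    by (rule measurable_cong[THEN iffD1, rotated]) 
       (auto simp: space_pair_measure intro!: arg_cong[where f = "emeasure \<nu>"])
qed

text \<open>Stationarity recast as an image of a product measure, so that Fubini extends it from
  sets to integrands.\<close>

lemma distr_apply: "distr (\<mu> \<Otimes>\<^sub>M \<nu>) borel (\<lambda>(i, y). f i y) = \<nu>"
proof (rule measure_eqI)
  fix A assume "A \<in> sets (distr (\<mu> \<Otimes>\<^sub>M \<nu>) borel (\<lambda>(i, y). f i y))"
  then have [measurable]: "A \<in> sets borel" by simp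
  have "emeasure (distr (\<mu> \<Otimes>\<^sub>M \<nu>) borel (\<lambda>(i, y). f i y)) A =
      emeasure (\<mu> \<Otimes>\<^sub>M \<nu>) ((\<lambda>(i, y). f i y) -` A \<inter> space (\<mu> \<Otimes>\<^sub>M \<nu>))"
    by (rule emeasure_distr) measurable
  also have "\<dots> = (\<integral>\<^sup>+ i. emeasure \<nu> (f i -` A) \<partial>\<mu>)"
    by (subst \<nu>.emeasure_pair_measure_alt, measurable)
       (auto simp: space_pair_measure intro!: nn_integral_cong arg_cong[where f = "emeasure \<nu>"])
  finally show "emeasure (distr (\<mu> \<Otimes>\<^sub>M \<nu>) borel (\<lambda>(i, y). f i y)) A = emeasure \<nu> A"
    by (simp add: emeasure_nu_eq)
qed simp

lemma nn_integral_stationary: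
  assumes [measurable]: "h \<in> borel_measurable borel"
  shows "(\<integral>\<^sup>+ y. \<integral>\<^sup>+ i. h (f i y) \<partial>\<mu> \<partial>\<nu>) = (\<integral>\<^sup>+ y. h y \<partial>\<nu>)"
proof -
  have "(\<integral>\<^sup>+ y. h y \<partial>\<nu>) = (\<integral>\<^sup>+ y. h y \<partial>distr (\<mu> \<Otimes>\<^sub>M \<nu>) borel (\<lambda>(i, y). f i y))"
    by (simp add: distr_apply)
  also have "\<dots> = (\<integral>\<^sup>+ x. h (f (fst x) (snd x)) \<partial>(\<mu> \<Otimes>\<^sub>M \<nu>))"
    by (subst nn_integral_distr) (auto simp: case_prod_beta)
  also have "\<dots> = (\<integral>\<^sup>+ y. \<integral>\<^sup>+ i. h (f i y) \<partial>\<mu> \<partial>\<nu>)"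
    by (subst pair.nn_integral_snd[symmetric]) auto
  finally show ?thesis ..
qed

lemma measurable_random_orbit [measurable]:
  "(\<lambda>(w, y). random_orbit f w n y) \<in> borel_measurable (S \<Otimes>\<^sub>M borel)"
proof (induction n)
  case (Suc n)
  have "(\<lambda>x. (fst x n, random_orbit f (fst x) n (snd x))) \<in> measurable (S \<Otimes>\<^sub>M borel) (\<mu> \<Otimes>\<^sub>M borel)"
    using Suc by (intro measurable_Pair) (auto simp: case_prod_beta)
  from measurable_compose[OF this measurable_apply] show ?case
    by (simp add: case_prod_beta)
qed simp

lemma measurable_random_orbit_left [measurable]:
  "(\<lambda>w. random_orbit f w n y) \<in> borel_measurable S"
  using measurable_compose[OF measurable_Pair2'[of y borel S] measurable_random_orbit] by simp

lemma measurable_hit [measurable]: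
  assumes [measurable]: "A \<in> sets borel"
  shows "(\<lambda>y. \<integral>\<^sup>+ w. indicator A (random_orbit f w n y) \<partial>S :: ennreal) \<in> borel_measurable borel"
proof -
  have "(\<lambda>(y, w). indicator A (random_orbit f w n y) :: ennreal) \<in> borel_measurable (borel \<Otimes>\<^sub>M S)"
    using measurable_compose[OF measurable_pair_swap' measurable_random_orbit[of n]]
    by (simp add: case_prod_beta)
  then show ?thesis by (rule P.borel_measurable_nn_integral)
qed

text \<open>Induction on \<open>n\<close> by conditioning on the first map: the rest is an orbit of
  length \<open>n\<close> started at the image point, and stationarity absorbs the extra
  step.\<close>

lemma nn_integral_random_orbit:
  assumes [measurable]: "A \<in> sets borel"
  shows "(\<integral>\<^sup>+ y. \<integral>\<^sup>+ w. indicator A (random_orbit f w n y) \<partial>S \<partial>\<nu>) = emeasure \<nu> A"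
proof (induction n)
  case 0
  then show ?case by (simp add: P.emeasure_space_1)
next
  case (Suc n)
  let ?H = "\<lambda>n y. \<integral>\<^sup>+ w. indicator A (random_orbit f w n y) \<partial>S :: ennreal"
  \<comment> \<open>The Markov property. By \<open>PiM_iter\<close> the law of \<open>w\<close> is
    that of an independent first index put in front of a fresh sequence.\<close>
  have "?H (Suc n) y = (\<integral>\<^sup>+ i. ?H n (f i y) \<partial>\<mu>)" for y
  proof -
    have "?H (Suc n) y = (\<integral>\<^sup>+ w. indicator A (random_orbit f w (Suc n) y) 
        \<partial>distr (\<mu> \<Otimes>\<^sub>M S) S (\<lambda>(s, \<omega>). case_nat s \<omega>))"
      by (simp only: PiM_iter)
    also have "\<dots> = (\<integral>\<^sup>+ x. indicator A (random_orbit f (case_nat (fst x) (snd x)) (Suc n) y) \<partial>(\<mu> \<Otimes>\<^sub>M S))"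
      by (subst nn_integral_distr) (auto simp: case_prod_beta simp del: random_orbit.simps)
    also have "\<dots> = (\<integral>\<^sup>+ x. indicator A (random_orbit f (snd x) n (f (fst x) y)) \<partial>(\<mu> \<Otimes>\<^sub>M S))"
      by (simp only: random_orbit_case_nat)
    also have "\<dots> = (\<integral>\<^sup>+ i. ?H n (f i y) \<partial>\<mu>)"
    proof -
      have "(\<lambda>x. (snd x, apply_bcontfun (f (fst x)) y)) \<in> measurable (\<mu> \<Otimes>\<^sub>M S) (S \<Otimes>\<^sub>M borel)"
        by measurable
      from measurable_compose[OF this measurable_random_orbit[of n]]
      have [measurable]: "(\<lambda>x. random_orbit f (snd x) n (f (fst x) y)) \<in> borel_measurable (\<mu> \<Otimes>\<^sub>M S)"
        by simp
      show ?thesis by (subst P.nn_integral_fst[symmetric]) auto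
    qed
    finally show ?thesis .
  qed
  then show ?case using nn_integral_stationary[of "?H n"] Suc by simp
qed

section \<open>Points of maximal mass and the common fixed point\<close>

lemma emeasure_vimage_singleton_le:
  assumes "i \<in> I" "\<And>x. emeasure \<nu> {x} \<le> m"
  shows "emeasure \<nu> (f i -` {x}) \<le> m"
proof (cases "f i -` {x} = {}")
  case False
  then obtain y where "f i -` {x} = {y}"
    using inj[OF assms(1)] by (auto simp: inj_def)
  then show ?thesis using assms(2) by simp
qed simp

text \<open>The mass of \<open>x\<close> is the average over \<open>i\<close> of the masses of its
  preimages. By injectivity each preimage has at most one point, hence at most the maximal mass; an
  average attaining its upper bound attains it almost everywhere.\<close>

lemma AE_maximal_preimage:
  assumes max: "\<And>y. emeasure \<nu> {y} \<le> emeasure \<nu> {x}"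
  shows "AE i in \<mu>. emeasure \<nu> {x} \<le> emeasure \<nu> (f i -` {x})"
proof -
  let ?h = "\<lambda>i. emeasure \<nu> (f i -` {x})"
  have le: "AE i in \<mu>. ?h i \<le> emeasure \<nu> {x}"
    using AE_space by eventually_elim (simp add: emeasure_vimage_singleton_le[OF _ max])
  have "(\<integral>\<^sup>+ i. emeasure \<nu> {x} - ?h i \<partial>\<mu>) = (\<integral>\<^sup>+ i. emeasure \<nu> {x} \<partial>\<mu>) - (\<integral>\<^sup>+ i. ?h i \<partial>\<mu>)"
    using le emeasure_nu_eq[of "{x}"] by (intro nn_integral_diff) auto
  also have "\<dots> = 0"
    using \<mu>.emeasure_space_1 by (simp add: emeasure_nu_eq[of "{x}", symmetric])
  finally have "AE i in \<mu>. emeasure \<nu> {x} - ?h i = 0"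
    by (subst (asm) nn_integral_0_iff_AE) auto
  then show ?thesis by eventually_elim (simp add: diff_eq_0_iff_ennreal)
qed

text \<open>If \<open>f i\<close> moved a point of \<open>K\<close> off the closed set
  \<open>K\<close>, so would every map uniformly close to \<open>f i\<close>, and such maps occur
  with positive probability.\<close>

lemma AE_invariant_imp_invariant:
  assumes "closed K" "AE i in \<mu>. f i ` K \<subseteq> K" "i \<in> I"
  shows "f i ` K \<subseteq> K"
proof (rule ccontr)
  assume "\<not> ?thesis"
  then obtain x where x: "x \<in> K" "f i x \<in> - K" by auto
  then obtain e where e: "e > 0" "ball (f i x) e \<subseteq> - K"
    using assms(1) open_contains_ball[of "- K"] by (auto simp: open_Compl)
  obtain j where "dist (f j) (f i) < e" "f j ` K \<subseteq> K"
    using support_AE_ex[OF assms(2,3) e(1)] by blast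
  then have "f j x \<in> K" "dist (f i x) (f j x) < e"
    using x(1) dist_bounded[of "f j" x "f i"] by (auto simp: dist_commute)
  then show False using e(2) by auto
qed

lemma maximal_points_invariant:
  assumes m: "m > 0" "\<And>x. emeasure \<nu> {x} \<le> m"
    and K: "K = {x. emeasure \<nu> {x} = m}" "finite K" and i: "i \<in> I"
  shows "f i ` K \<subseteq> K"
proof (rule AE_invariant_imp_invariant[OF finite_imp_closed[OF K(2)] _ i])
  have "AE j in \<mu>. \<forall>x\<in>K. m \<le> emeasure \<nu> (f j -` {x})"
    using AE_maximal_preimage m K by (intro AE_finite_allI) auto
  then show "AE j in \<mu>. f j ` K \<subseteq> K"
    using AE_space
  proof eventually_elim
    fix j assume j: "\<forall>x\<in>K. m \<le> emeasure \<nu> (f j -` {x})" "j \<in> space \<mu>"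
    have sub: "K \<subseteq> f j ` K"
    proof
      fix x assume "x \<in> K"
      then have x: "m \<le> emeasure \<nu> (f j -` {x})" using j by auto
      then have "f j -` {x} \<noteq> {}" using m(1) by auto
      then obtain y where y: "f j -` {x} = {y}"
        using inj[of j] j(2) by (auto simp: inj_def)
      then have "emeasure \<nu> {y} = m" using x m(2)[of y] by simp
      then show "x \<in> f j ` K" using y K by auto
    qed
    \<comment> \<open>\<open>K\<close> is finite and its image has no more points than
      \<open>K\<close>, so the inclusion \<open>sub\<close> is an equality.\<close>
    then have "K = f j ` K"
      using K(2) by (intro card_seteq) (auto simp: card_image_le)
    then show "f j ` K \<subseteq> K" by simp
  qed
qed

lemma point_mass_imp_fixed_point:
  assumes prox: "proximal I f" and pos: "emeasure \<nu> {x} > 0"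
  obtains x\<^sub>0 where "emeasure \<nu> {x\<^sub>0} > 0" "\<And>i. i \<in> I \<Longrightarrow> f i x\<^sub>0 = x\<^sub>0"
proof -
  let ?p = "\<lambda>x. measure \<nu> {x}"
  have fin: "finite {y. ?p y \<ge> c}" if "c > 0" for c
    by (rule \<nu>.finite_large_points) (use that in auto)
  have p: "?p x > 0" using pos by (simp add: \<nu>.emeasure_eq_measure)
  \<comment> \<open>Finitely many points are at least as heavy as \<open>x\<close>, so a maximum
    exists among them; it is global since all other points are lighter than
    \<open>x\<close>.\<close>
  define m where "m = Max (?p ` {y. ?p y \<ge> ?p x})"
  have "m \<in> ?p ` {y. ?p y \<ge> ?p x}"
    unfolding m_def using fin[OF p] by (intro Max_in) auto
  then obtain x\<^sub>0 where x\<^sub>0: "?p x\<^sub>0 = m" "m \<ge> ?p x" by auto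
  have le: "?p y \<le> m" for y
  proof (cases "?p y \<ge> ?p x")
    case True
    then show ?thesis unfolding m_def using fin[OF p] by (intro Max_ge) auto
  qed (use x\<^sub>0 in linarith)
  define K where "K = {y. ?p y = m}"
  have m: "m > 0" using p x\<^sub>0 by linarith
  have K: "finite K" by (rule finite_subset[OF _ fin[OF m]]) (auto simp: K_def)
  have inv: "f i ` K \<subseteq> K" if "i \<in> I" for i
    by (rule maximal_points_invariant[of "ennreal m"])
       (use le m K that in \<open>auto simp: K_def \<nu>.emeasure_eq_measure ennreal_leI\<close>)
  have eq: "y = x\<^sub>0" if y: "y \<in> K" for y
  proof (rule ccontr)
    assume ne: "y \<noteq> x\<^sub>0"
    obtain w r where w: "\<And>k. w k \<in> I"
      and lim: "(\<lambda>k. dist (random_orbit f w (r k) y) (random_orbit f w (r k) x\<^sub>0)) \<longlonglongrightarrow> 0"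
      using prox unfolding proximal_def by blast
    \<comment> \<open>Two distinct points of \<open>K\<close> have distinct orbits inside
      \<open>K\<close>, by injectivity. Their distances stay in the finite set \<open>?D\<close>,
      which omits 0, so they cannot tend to 0 along a subsequence as proximality demands.\<close>
    let ?D = "(\<lambda>(a, b). dist a b) ` {(a, b) \<in> K \<times> K. a \<noteq> b}"
    have "finite ?D"
      by (rule finite_imageI, rule finite_subset[of _ "K \<times> K"]) (use K in auto)
    then have "closed ?D" by (rule finite_imp_closed)
    moreover have "dist (random_orbit f w n y) (random_orbit f w n x\<^sub>0) \<in> ?D" for n
    proof -
      have "random_orbit f w n y \<in> K" "random_orbit f w n x\<^sub>0 \<in> K"
        by (rule random_orbit_in; use inv w y x\<^sub>0(1) in \<open>simp add: K_def\<close>)+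
      moreover have "random_orbit f w n y \<noteq> random_orbit f w n x\<^sub>0"
        using injD[OF random_orbit_inj[of f w n, OF inj[OF w]]] ne by blast
      ultimately show ?thesis
        by (intro image_eqI[of _ _ "(random_orbit f w n y, random_orbit f w n x\<^sub>0)"]) auto
    qed
    ultimately have "0 \<in> ?D"
      by (intro Lim_in_closed_set[OF _ _ _ lim] always_eventually allI) simp_all
    then show False by auto
  qed
  show thesis
  proof (rule that)
    show "emeasure \<nu> {x\<^sub>0} > 0" using x\<^sub>0 m by (simp add: \<nu>.emeasure_eq_measure)
    show "f i x\<^sub>0 = x\<^sub>0" if "i \<in> I" for i
      by (rule eq) (use inv[OF that] x\<^sub>0(1) in \<open>auto simp: K_def\<close>)
  qed
qed

section \<open>From a common fixed point to the Dirac measure\<close>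

lemma basin_probability:
  assumes lc: "local_contraction f \<mu>" and fixed: "\<And>i. i \<in> I \<Longrightarrow> f i x\<^sub>0 = x\<^sub>0"
  obtains d where "d > 0"
    "\<And>y. y \<in> ball x\<^sub>0 d \<Longrightarrow> prob {w \<in> space S. (\<lambda>n. dist (random_orbit f w n y) x\<^sub>0) \<longlonglongrightarrow> 0} \<ge> 1 / 2"
proof -
  let ?C = "\<lambda>y. {w \<in> space S. (\<lambda>n. dist (random_orbit f w n y) x\<^sub>0) \<longlonglongrightarrow> 0}"
  obtain q where q: "0 < q" "q < 1"
    and "AE w in S. \<exists>B. x\<^sub>0 \<in> interior B \<and> (\<forall>n\<ge>1. diameter (random_orbit f w n ` B) \<le> q ^ n)"
    using lc unfolding local_contraction_def by blast
  from this(3) AE_space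
  have near: "AE w in S. \<forall>\<^sub>F y in nhds x\<^sub>0. w \<in> ?C y"
  proof eventually_elim
    fix w assume w: "w \<in> space S"
      and "\<exists>B. x\<^sub>0 \<in> interior B \<and> (\<forall>n\<ge>1. diameter (random_orbit f w n ` B) \<le> q ^ n)"
    then obtain B where B: "x\<^sub>0 \<in> interior B" "\<And>n. n \<ge> 1 \<Longrightarrow> diameter (random_orbit f w n ` B) \<le> q ^ n"
      by blast
    have "w \<in> ?C y" if y: "y \<in> interior B" for y
    proof -
      have "dist (random_orbit f w n y) x\<^sub>0 \<le> q ^ n" if "n \<ge> 1" for n
      proof -
        have "random_orbit f w n x\<^sub>0 = x\<^sub>0"
          by (rule random_orbit_fixed) (use fixed in_space_S[OF w] in auto)
        moreover have "bounded (random_orbit f w n ` B)"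
          using bounded_subset[OF compact_imp_bounded[OF compact]] by blast
        then have "dist (random_orbit f w n y) (random_orbit f w n x\<^sub>0) \<le> diameter (random_orbit f w n ` B)"
          by (rule diameter_bounded_bound) (use y B(1) interior_subset in auto)
        ultimately show ?thesis using B(2)[OF that] by simp
      qed
      then have "\<forall>\<^sub>F n in sequentially. norm (dist (random_orbit f w n y) x\<^sub>0) \<le> q ^ n"
        by (auto simp: eventually_sequentially)
      then have "(\<lambda>n. dist (random_orbit f w n y) x\<^sub>0) \<longlonglongrightarrow> 0"
        by (rule Lim_null_comparison) (use q in \<open>simp add: LIMSEQ_power_zero\<close>)
      then show ?thesis using w by simp
    qed
    then show "\<forall>\<^sub>F y in nhds x\<^sub>0. w \<in> ?C y"
      using B(1) unfolding eventually_nhds by (intro exI[of _ "interior B"]) auto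
  qed
  have C: "?C y \<in> sets S" for y
  proof -
    have [measurable]: "(\<lambda>w. dist (random_orbit f w n y) x\<^sub>0) \<in> borel_measurable S" for n
      by (rule measurable_compose[OF measurable_random_orbit_left])
         (intro borel_measurable_continuous_onI continuous_intros)
    have "?C y = {w \<in> space S. \<forall>k. \<exists>N. \<forall>n\<ge>N. dist (random_orbit f w n y) x\<^sub>0 < inverse (real (Suc k))}"
      by (simp only: nonneg_tendsto_0_iff[OF zero_le_dist])
    also have "\<dots> \<in> sets S" by measurable
    finally show ?thesis .
  qed
  \<comment> \<open>The neighbourhood in \<open>near\<close> depends on \<open>w\<close>. A radius
    valid for all \<open>w\<close> at once is traded for a probability bound: along any sequence
    \<open>y k\<close> tending to \<open>x\<^sub>0\<close> the indicators of \<open>?C (y k)\<close>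
    tend to 1 almost surely, so by dominated convergence their probabilities tend to 1. Any constant
    below 1 could replace 1/2.\<close>
  have "\<exists>d>0. \<forall>y\<in>ball x\<^sub>0 d. prob (?C y) \<ge> 1 / 2"
  proof (rule ccontr)
    assume "\<not> ?thesis"
    then have no: "\<exists>y\<in>ball x\<^sub>0 e. \<not> prob (?C y) \<ge> 1 / 2" if "e > 0" for e
      using that by blast
    have "\<forall>k. \<exists>y. y \<in> ball x\<^sub>0 (inverse (real (Suc k))) \<and> prob (?C y) < 1 / 2"
    proof
      fix k
      have "inverse (real (Suc k)) > 0" by simp
      from no[OF this] show "\<exists>y. y \<in> ball x\<^sub>0 (inverse (real (Suc k))) \<and> prob (?C y) < 1 / 2"
        unfolding not_le by blast
    qed
    from choice[OF this] obtain y
      where y: "\<And>k. y k \<in> ball x\<^sub>0 (inverse (real (Suc k)))" "\<And>k. prob (?C (y k)) < 1 / 2"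
      by blast
    have ylim: "y \<longlonglongrightarrow> x\<^sub>0"
    proof (rule metric_tendsto_imp_tendsto[OF LIMSEQ_inverse_real_of_nat])
      show "\<forall>\<^sub>F k in sequentially. dist (y k) x\<^sub>0 \<le> dist (inverse (real (Suc k))) 0"
        using y(1) by (intro always_eventually allI) (simp add: dist_commute less_imp_le del: of_nat_Suc)
    qed
    have "(\<lambda>k. \<integral>w. indicator (?C (y k)) w \<partial>S) \<longlonglongrightarrow> (\<integral>w. (1::real) \<partial>S)"
    proof (rule integral_dominated_convergence[where w = "\<lambda>_. 1"])
      show "AE w in S. (\<lambda>k. indicator (?C (y k)) w :: real) \<longlonglongrightarrow> 1"
        using near
      proof eventually_elim
        fix w assume "\<forall>\<^sub>F z in nhds x\<^sub>0. w \<in> ?C z"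
        then have "\<forall>\<^sub>F k in sequentially. w \<in> ?C (y k)"
          using ylim by (rule eventually_compose_filterlim)
        then have "\<forall>\<^sub>F k in sequentially. indicator (?C (y k)) w = (1::real)"
          by eventually_elim simp
        then show "(\<lambda>k. indicator (?C (y k)) w :: real) \<longlonglongrightarrow> 1"
          by (rule tendsto_eventually)
      qed
    qed (auto intro!: borel_measurable_indicator C split: split_indicator)
    moreover have "?C z \<inter> space S = ?C z" for z by auto
    ultimately have "(\<lambda>k. prob (?C (y k))) \<longlonglongrightarrow> 1"
      by (simp only: Bochner_Integration.integral_indicator P.prob_space lebesgue_integral_const
          real_scaleR_def mult_1_right)
    then have "1 \<le> (1 / 2 :: real)"
      by (rule LIMSEQ_le_const2) (use y(2) less_imp_le in blast)
    then show False by simp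
  qed
  then show thesis using that by blast
qed

lemma fixed_point_isolated:
  assumes lc: "local_contraction f \<mu>" and fixed: "\<And>i. i \<in> I \<Longrightarrow> f i x\<^sub>0 = x\<^sub>0"
  obtains d where "d > 0" "emeasure \<nu> (ball x\<^sub>0 d - {x\<^sub>0}) = 0"
proof -
  obtain d where d: "d > 0"
    "\<And>y. y \<in> ball x\<^sub>0 d \<Longrightarrow> prob {w \<in> space S. (\<lambda>n. dist (random_orbit f w n y) x\<^sub>0) \<longlonglongrightarrow> 0} \<ge> 1 / 2"
    using basin_probability[OF lc fixed] by blast
  let ?C = "\<lambda>y. {w \<in> space S. (\<lambda>n. dist (random_orbit f w n y) x\<^sub>0) \<longlonglongrightarrow> 0}"
  \<comment> \<open>A lower bound for the asymptotic probability that the orbit of \<open>y\<close>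
    lies in a small ball around \<open>x\<^sub>0\<close>: 1 at the fixed point, 1/2 on the punctured
    ball, 0 elsewhere.\<close>
  let ?b = "\<lambda>y. indicator {x\<^sub>0} y + ennreal (1 / 2) * indicator (ball x\<^sub>0 d - {x\<^sub>0}) y"
  let ?H = "\<lambda>r n y. \<integral>\<^sup>+ w. indicator (cball x\<^sub>0 r) (random_orbit f w n y) \<partial>S :: ennreal"
  have hit: "?b y \<le> liminf (\<lambda>n. ?H r n y)" if r: "r > 0" for r y
  proof (cases "y = x\<^sub>0")
    case True
    have "random_orbit f w n x\<^sub>0 = x\<^sub>0" if "w \<in> space S" for w n
      by (rule random_orbit_fixed) (use fixed in_space_S[OF that] in auto)
    then have "?H r n x\<^sub>0 = (\<integral>\<^sup>+ w. 1 \<partial>S)" for n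
      using r by (intro nn_integral_cong) simp
    then show ?thesis using True P.emeasure_space_1 by (simp add: Liminf_const)
  next
    case False
    show ?thesis
    proof (cases "y \<in> ball x\<^sub>0 d")
      case True
      then have "prob (?C y) \<ge> 1 / 2" by (rule d(2))
      \<comment> \<open>\<open>measure\<close> is 0 on non-measurable sets, so the positive bound
        already yields measurability.\<close>
      then have C: "?C y \<in> sets S" using measure_notin_sets[of "?C y" S] by force
      have "?b y = ennreal (1 / 2)" using False True by simp
      also have "\<dots> \<le> ennreal (prob (?C y))" by (rule ennreal_leI) fact
      also have "\<dots> = (\<integral>\<^sup>+ w. indicator (?C y) w \<partial>S)"
        using C by (simp add: P.emeasure_eq_measure)
      \<comment> \<open>A convergent orbit is eventually in the ball; Fatou's lemma in
        \<open>w\<close> then moves the limit outside. Fatou's lemma in \<open>y\<close> is used in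
        the same way for \<open>le\<close>.\<close>
      also have "\<dots> \<le> (\<integral>\<^sup>+ w. liminf (\<lambda>n. indicator (cball x\<^sub>0 r) (random_orbit f w n y)) \<partial>S)"
      proof (intro nn_integral_mono)
        fix w
        show "indicator (?C y) w \<le> liminf (\<lambda>n. indicator (cball x\<^sub>0 r) (random_orbit f w n y) :: ennreal)"
        proof (cases "w \<in> ?C y")
          case True
          then have "\<forall>\<^sub>F n in sequentially. dist (random_orbit f w n y) x\<^sub>0 < r"
            using r by (auto dest: order_tendstoD(2))
          then have "\<forall>\<^sub>F n in sequentially. 1 \<le> (indicator (cball x\<^sub>0 r) (random_orbit f w n y) :: ennreal)"
            by eventually_elim (simp add: dist_commute)
          then show ?thesis using True by (auto intro!: Liminf_bounded)
        qed simp
      qed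
      also have "\<dots> \<le> liminf (\<lambda>n. ?H r n y)"
        by (intro nn_integral_liminf measurable_compose[OF measurable_random_orbit_left]
              borel_measurable_indicator) auto
      finally show ?thesis .
    qed (use False in simp)
  qed
  have le: "emeasure \<nu> {x\<^sub>0} + ennreal (1 / 2) * emeasure \<nu> (ball x\<^sub>0 d - {x\<^sub>0}) \<le> emeasure \<nu> (cball x\<^sub>0 r)"
    if r: "r > 0" for r
  proof -
    have meas: "{x\<^sub>0} \<in> sets \<nu>" "ball x\<^sub>0 d - {x\<^sub>0} \<in> sets \<nu>"
      "indicator {x\<^sub>0} \<in> borel_measurable \<nu>"
      "(\<lambda>y. ennreal (1 / 2) * indicator (ball x\<^sub>0 d - {x\<^sub>0}) y) \<in> borel_measurable \<nu>"
      by (auto intro!: borel_measurable_times_ennreal borel_measurable_indicator)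
    have "emeasure \<nu> {x\<^sub>0} + ennreal (1 / 2) * emeasure \<nu> (ball x\<^sub>0 d - {x\<^sub>0}) = (\<integral>\<^sup>+ y. ?b y \<partial>\<nu>)"
      by (subst nn_integral_add) (simp_all only: nn_integral_cmult_indicator nn_integral_indicator meas)
    also have "\<dots> \<le> (\<integral>\<^sup>+ y. liminf (\<lambda>n. ?H r n y) \<partial>\<nu>)"
      by (intro nn_integral_mono hit r)
    also have "\<dots> \<le> liminf (\<lambda>n. \<integral>\<^sup>+ y. ?H r n y \<partial>\<nu>)"
      using measurable_hit[of "cball x\<^sub>0 r"]
      by (intro nn_integral_liminf) (simp cong: measurable_cong_sets)
    also have "\<dots> = emeasure \<nu> (cball x\<^sub>0 r)"
      by (simp add: nn_integral_random_orbit Liminf_const)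
    finally show ?thesis .
  qed
  let ?A = "\<lambda>n. cball x\<^sub>0 (inverse (real (Suc n)))"
  have "(\<Inter>n. ?A n) = {x\<^sub>0}"
  proof (intro equalityI subsetI)
    fix y assume y: "y \<in> (\<Inter>n. ?A n)"
    show "y \<in> {x\<^sub>0}"
    proof (rule ccontr)
      assume "y \<notin> {x\<^sub>0}"
      then obtain n where "inverse (real (Suc n)) < dist x\<^sub>0 y"
        using reals_Archimedean[of "dist x\<^sub>0 y"] by auto
      moreover have "dist x\<^sub>0 y \<le> inverse (real (Suc n))" using y by (simp del: of_nat_Suc)
      ultimately show False by linarith
    qed
  qed (simp del: of_nat_Suc)
  moreover have "decseq ?A"
    unfolding decseq_def by (auto intro!: subset_cball le_imp_inverse_le)
  ultimately have "(\<lambda>n. emeasure \<nu> (?A n)) \<longlonglongrightarrow> emeasure \<nu> {x\<^sub>0}"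
    using Lim_emeasure_decseq[of ?A \<nu>] by (simp add: image_subset_iff)
  \<comment> \<open>Letting the radius in \<open>le\<close> shrink to 0; as \<nu> is finite, the
    mass of \<open>x\<^sub>0\<close> cancels and the punctured ball is null.\<close>
  then have "emeasure \<nu> {x\<^sub>0} + ennreal (1 / 2) * emeasure \<nu> (ball x\<^sub>0 d - {x\<^sub>0}) \<le> emeasure \<nu> {x\<^sub>0}"
    by (rule LIMSEQ_le_const) (use le in \<open>simp del: of_nat_Suc\<close>)
  then have "emeasure \<nu> (ball x\<^sub>0 d - {x\<^sub>0}) = 0"
    by (simp add: \<nu>.emeasure_eq_measure flip: ennreal_mult' ennreal_plus)
  with d(1) show thesis by (rule that)
qed

text \<open>Stationarity makes the preimage of the null set \<open>U - {x\<^sub>0}\<close> null only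
  for almost every index. Full support supplies such a \<open>j\<close> with \<open>f j\<close>
  uniformly close to \<open>f i\<close>, close enough to send a neighbourhood of \<open>y\<close>
  into \<open>U\<close>; injectivity keeps points other than \<open>x\<^sub>0\<close> away from
  \<open>x\<^sub>0\<close>.\<close>

lemma locally_null_preimage:
  assumes fixed: "\<And>i. i \<in> I \<Longrightarrow> f i x\<^sub>0 = x\<^sub>0"
    and U: "open U" "emeasure \<nu> (U - {x\<^sub>0}) = 0" and i: "i \<in> I" "f i y \<in> U"
  shows "\<exists>V. open V \<and> y \<in> V \<and> emeasure \<nu> (V - {x\<^sub>0}) = 0"
proof -
  have [measurable]: "U - {x\<^sub>0} \<in> sets borel" using U(1) by auto
  have "(\<integral>\<^sup>+ j. emeasure \<nu> (f j -` (U - {x\<^sub>0})) \<partial>\<mu>) = 0"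
    using emeasure_nu_eq[of "U - {x\<^sub>0}"] U by simp
  then have ae: "AE j in \<mu>. emeasure \<nu> (f j -` (U - {x\<^sub>0})) = 0"
    by (subst (asm) nn_integral_0_iff_AE) auto
  obtain e where e: "e > 0" "ball (f i y) e \<subseteq> U"
    using U(1) i(2) open_contains_ball by blast
  obtain j where j: "j \<in> I" "dist (f j) (f i) < e / 2" "emeasure \<nu> (f j -` (U - {x\<^sub>0})) = 0"
    using support_AE_ex[OF ae i(1), of "e / 2"] e(1) by auto
  \<comment> \<open>One half of \<open>e\<close> pays for the variation of \<open>f i\<close> on
    \<open>?V\<close>, the other for replacing \<open>f i\<close> by \<open>f j\<close>.\<close>
  let ?V = "{z. dist (f i y) (f i z) < e / 2}"
  have V: "open ?V"
    by (intro open_Collect_less continuous_intros continuous_on_apply_bcontfun)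
  have "?V - {x\<^sub>0} \<subseteq> f j -` (U - {x\<^sub>0})"
  proof
    fix z assume z: "z \<in> ?V - {x\<^sub>0}"
    have "dist (f i y) (f j z) < e"
      using z dist_bounded[of "f j" z "f i"] j(2) dist_triangle[of "f i y" "f j z" "f i z"]
      by (auto simp: dist_commute)
    moreover have "f j z \<noteq> x\<^sub>0"
      using inj[OF j(1)] fixed[OF j(1)] z by (metis DiffD2 injD singletonI)
    ultimately show "z \<in> f j -` (U - {x\<^sub>0})" using e(2) by auto
  qed
  moreover have "f j -` (U - {x\<^sub>0}) \<in> sets \<nu>"
    using measurable_sets[OF measurable_f[of j], of "U - {x\<^sub>0}"] by simp
  ultimately have "emeasure \<nu> (?V - {x\<^sub>0}) = 0"
    using emeasure_mono j(3) by (metis le_zero_eq)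
  then show ?thesis using V e(1) by (intro exI[of _ ?V]) simp
qed

lemma fixed_point_imp_dirac:
  assumes prox: "proximal I f" and lc: "local_contraction f \<mu>"
    and fixed: "\<And>i. i \<in> I \<Longrightarrow> f i x\<^sub>0 = x\<^sub>0"
  shows "\<nu> = return borel x\<^sub>0"
proof -
  obtain d where d: "d > 0" "emeasure \<nu> (ball x\<^sub>0 d - {x\<^sub>0}) = 0"
    using fixed_point_isolated[OF lc fixed] by blast
  let ?P = "\<lambda>y. \<exists>V. open V \<and> y \<in> V \<and> emeasure \<nu> (V - {x\<^sub>0}) = 0"
  have "?P y" for y
  proof -
    \<comment> \<open>Proximality of \<open>y\<close> and \<open>x\<^sub>0\<close>, whose orbit is
      constant, steers \<open>y\<close> into the ball; \<open>?P\<close> is then pulled back along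
      that orbit one map at a time.\<close>
    obtain w r where w: "\<And>k. w k \<in> I"
      and lim: "(\<lambda>k. dist (random_orbit f w (r k) y) (random_orbit f w (r k) x\<^sub>0)) \<longlonglongrightarrow> 0"
      using prox unfolding proximal_def by blast
    have "random_orbit f w n x\<^sub>0 = x\<^sub>0" for n
      by (rule random_orbit_fixed) (use fixed w in auto)
    then obtain k where "dist (random_orbit f w (r k) y) x\<^sub>0 < d"
      using order_tendstoD(2)[OF lim d(1)] by (auto simp: eventually_sequentially)
    then have "?P (random_orbit f w (r k) y)"
      using d by (intro exI[of _ "ball x\<^sub>0 d"]) (simp add: dist_commute)
    moreover have "?P (random_orbit f w n y) \<Longrightarrow> ?P y" for n
    proof (induction n)
      case (Suc n)
      then show ?case using locally_null_preimage[OF fixed] w by (metis comp_apply random_orbit.simps(2))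
    qed simp
    ultimately show ?thesis by blast
  qed
  then have "emeasure \<nu> (- {x\<^sub>0}) = 0"
    by (intro compact_locally_null[OF compact sets_nu]) (auto simp: Diff_eq Int_commute)
  then have ae: "AE y in \<nu>. y = x\<^sub>0"
    by (intro AE_I[of _ _ "- {x\<^sub>0}"]) auto
  show ?thesis
  proof (rule measure_eqI)
    fix A assume A: "A \<in> sets \<nu>"
    have "emeasure \<nu> A = emeasure \<nu> (if x\<^sub>0 \<in> A then space \<nu> else {})"
      by (rule emeasure_eq_AE) (use ae A in \<open>auto elim: eventually_mono\<close>)
    then show "emeasure \<nu> A = emeasure (return borel x\<^sub>0) A"
      using A \<nu>.emeasure_space_1 by simp
  qed simp
qed

end

text \<open>Makes the two alternatives of the dichotomy mutually exclusive.\<close>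

lemma return_has_atom: "measure_atom (return borel x) {x :: 'a::t1_space}"
  by (auto simp: measure_atom_def subset_singleton_iff)

theorem corollary1p3:
  fixes I :: "'i set"
    and f :: "'i \<Rightarrow> ('a::metric_space \<Rightarrow>\<^sub>C 'a)"
    and \<mu> :: "'i measure"
    and \<nu> :: "'a measure"
  assumes "compact (UNIV :: 'a set)"
    and "random_dynamical_system I f \<mu>"
    and "proximal I f"
    and "local_contraction f \<mu>"
    and "stationary f \<mu> \<nu>"
    and "\<And>i. i \<in> I \<Longrightarrow> inj (apply_bcontfun (f i))"
  shows "((\<exists>x\<^sub>0. \<nu> = return borel x\<^sub>0 \<and> (AE i in \<mu>. f i x\<^sub>0 = x\<^sub>0)) \<or> non_atomic \<nu>) \<and>
    \<not> ((\<exists>x\<^sub>0. \<nu> = return borel x\<^sub>0 \<and> (AE i in \<mu>. f i x\<^sub>0 = x\<^sub>0)) \<and> non_atomic \<nu>)"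
proof -
  interpret compact_rds I f \<mu> \<nu>
    by unfold_locales (use assms in auto)
  have "\<exists>x\<^sub>0. \<nu> = return borel x\<^sub>0 \<and> (AE i in \<mu>. f i x\<^sub>0 = x\<^sub>0)" if atomic: "\<not> non_atomic \<nu>"
  proof -
    obtain A where "measure_atom \<nu> A"
      using atomic by (auto simp: non_atomic_def)
    then obtain x where "emeasure \<nu> {x} > 0"
      using atom_imp_point_mass[OF assms(1) sets_nu] by blast
    then obtain x\<^sub>0 where fixed: "\<And>i. i \<in> I \<Longrightarrow> f i x\<^sub>0 = x\<^sub>0"
      using point_mass_imp_fixed_point[OF assms(3)] by blast
    then have "AE i in \<mu>. f i x\<^sub>0 = x\<^sub>0" by (intro AE_I2) simp
    then show ?thesis using fixed_point_imp_dirac[OF assms(3,4) fixed] by blast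
  qed
  moreover have "\<not> non_atomic \<nu>" if "\<nu> = return borel x\<^sub>0" for x\<^sub>0
    using return_has_atom[of x\<^sub>0] unfolding that non_atomic_def by blast
  ultimately show ?thesis by blast
qed

end
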